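(* Let $n\ge 2$ and let $\mathcal{A}_n$ denote the set of arc permutations in $S_n$. Then $$ \sum_{\pi\in\mathcal{A}_n} t^{\mathrm{inv}(\pi)} \mathbf{x}^{\mathrm{Des}(\pi)}= \prod_{i=1}^{n-1}(1+t^i x_i)+ \sum_{j=1}^{n-2}\left((t^{j(n-j)}x_j+t^{n-j-1}x_{j+1})\prod_{i=1}^{j-1}(1+t^i x_i)\prod_{i=j+2}^{n-1}(1+t^{n-i} x_i)\right). $$
   Context: An interval of $\mathbb{Z}_n$ is a set of the form $\{a,a+1,\dots,b\}$ or $\{b,b+1,\dots,n,1,2,\dots,a\}$ with $1\le a\le b\le n$. A permutation $\pi\in S_n$ is an arc permutation if for every $1\le j\le n$ the set $\{\pi(1),\dots,\pi(j)\}$ is an interval of $\mathbb{Z}_n$. For $\pi\in S_n$, $\mathrm{Des}(\pi)=\{i:\pi(i)>\pi(i+1)\}$, $\mathrm{inv}(\pi)=\#\{i<j:\pi(i)>\pi(j)\}$, and for a set $D=\{i_1,\dots,i_k\}$, $\mathbf{x}^D=x_{i_1}\cdots x_{i_k}$. *)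

theory Defs
  imports "HOL-Combinatorics.Permutations" "HOL-Library.Poly_Mapping"
begin

definition cyclic_interval :: "nat \<Rightarrow> nat set \<Rightarrow> bool" where
  "cyclic_interval n I \<longleftrightarrow>
     (\<exists>a b. 1 \<le> a \<and> a \<le> b \<and> b \<le> n \<and> (I = {a..b} \<or> I = {b..n} \<union> {1..a}))"

definition arc_permutations :: "nat \<Rightarrow> (nat \<Rightarrow> nat) set" where
  "arc_permutations n =
     {\<pi>. \<pi> permutes {1..n} \<and> (\<forall>j. 1 \<le> j \<and> j \<le> n \<longrightarrow> cyclic_interval n (\<pi> ` {1..j}))}"

definition descents :: "nat \<Rightarrow> (nat \<Rightarrow> nat) \<Rightarrow> nat set" where
  "descents n \<pi> = {i. 1 \<le> i \<and> i < n \<and> \<pi> i > \<pi> (i + 1)}"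

definition inversions :: "nat \<Rightarrow> (nat \<Rightarrow> nat) \<Rightarrow> nat" where
  "inversions n \<pi> = card {(i, j). 1 \<le> i \<and> i < j \<and> j \<le> n \<and> \<pi> i > \<pi> j}"

lemma finite_arc_permutations: "finite (arc_permutations n)"
  by (rule finite_subset[OF _ finite_permutations[of "{1..n}"]]) (auto simp: arc_permutations_def)

text \<open>The polynomial ring over the integers in the indeterminates \<open>t, x\<^sub>0, x\<^sub>1, \<dots>\<close>:
  a monomial is a finitely supported exponent function on the indeterminates, a polynomial a
  finitely supported coefficient function on monomials, and multiplication on \<open>'a \<Rightarrow>\<^sub>0 'b\<close> is
  convolution. The indeterminate \<open>x\<^sub>0\<close> is not used.\<close>

datatype indet = T | X nat

type_synonym poly_tx = "(indet \<Rightarrow>\<^sub>0 nat) \<Rightarrow>\<^sub>0 int"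

definition indet_poly :: "indet \<Rightarrow> poly_tx" where
  "indet_poly v = Poly_Mapping.single (Poly_Mapping.single v 1) 1"

abbreviation tt :: poly_tx where
  "tt \<equiv> indet_poly T"

abbreviation xx :: "nat \<Rightarrow> poly_tx" where
  "xx i \<equiv> indet_poly (X i)"

end

theory Submission
  imports Defs
begin

text \<open>Read an arc permutation as a word. If every prefix is an interval of the integers, each new
  letter is either larger than all earlier ones (contributing \<open>1\<close>) or smaller than all of them
  (contributing \<open>t\<^sup>i x\<^sub>i\<close> after \<open>i\<close> letters); this gives the first product. Otherwise let \<open>j\<close> be the
  length of the prefix before the first one that wraps around. This prefix consists of the letters
  \<open>1, \<dots>, j\<close> and is followed by \<open>n\<close>, or it consists of \<open>n - j + 1, \<dots>, n\<close> and is followed by \<open>1\<close>.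
  From then on the unused letters form an interval of the integers, and each new letter but the
  last is its minimum or its maximum, which gives the factors \<open>1 + t\<^sup>n\<^sup>-\<^sup>i x\<^sub>i\<close>.\<close>

subsection \<open>Weights of words\<close>

text \<open>The parameter \<open>k\<close> is the position of the first letter of the word.\<close>

fun word_weight :: "'a::comm_semiring_1 \<Rightarrow> (nat \<Rightarrow> 'a) \<Rightarrow> nat \<Rightarrow> nat list \<Rightarrow> 'a" where
  "word_weight t x k [] = 1"
| "word_weight t x k [a] = 1"
| "word_weight t x k (a # b # cs) =
     t ^ length (filter (\<lambda>c. c < a) (b # cs)) * (if b < a then x k else 1) *
     word_weight t x (Suc k) (b # cs)"

lemma word_weight_Cons:
  "as \<noteq> [] \<Longrightarrow> word_weight t x k (a # as) =
     t ^ length (filter (\<lambda>c. c < a) as) * (if hd as < a then x k else 1) *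
     word_weight t x (Suc k) as"
  by (cases as) auto

text \<open>The inversions of \<open>p @ q\<close> lie within \<open>p\<close>, within
  \<open>q\<close>, or between the two. The only descent not seen by either part is at the junction,
  the position of the last letter of \<open>p\<close>. All later splittings of words use
  this.\<close>

lemma word_weight_append:
  assumes "p \<noteq> []" "q \<noteq> []"
  shows "word_weight t x k (p @ q) =
    word_weight t x k p * word_weight t x (k + length p) q *
    t ^ (\<Sum>a\<leftarrow>p. length (filter (\<lambda>c. c < a) q)) *
    (if hd q < last p then x (k + length p - 1) else 1)"
  using assms
proof (induction p arbitrary: k)
  case (Cons a p)
  show ?case
  proof (cases "p = []")
    case True
    then show ?thesis using Cons.prems by (simp add: word_weight_Cons algebra_simps)
  next
    case False
    have IH: "word_weight t x (Suc k) (p @ q) =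
      word_weight t x (Suc k) p * word_weight t x (Suc k + length p) q *
      t ^ (\<Sum>a\<leftarrow>p. length (filter (\<lambda>c. c < a) q)) *
      (if hd q < last p then x (Suc k + length p - 1) else 1)"
      using Cons False by blast
    have "word_weight t x k (a # p @ q) =
      t ^ length (filter (\<lambda>c. c < a) (p @ q)) * (if hd p < a then x k else 1) *
      word_weight t x (Suc k) (p @ q)"
      using False by (subst word_weight_Cons) auto
    moreover have "word_weight t x k (a # p) =
      t ^ length (filter (\<lambda>c. c < a) p) * (if hd p < a then x k else 1) *
      word_weight t x (Suc k) p"
      using False by (rule word_weight_Cons)
    ultimately show ?thesis
      using False unfolding IH by (simp add: power_add mult_ac)
  qed
qed simp

text \<open>Links the recursive weight to the inversion number and the descent set. The induction
  strips the first letter: the filter counts the inversions whose left index is \<open>k\<close>,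
  and the comparison with the next letter detects a descent at \<open>k\<close>.\<close>

lemma word_weight_map_upt:
  fixes f :: "nat \<Rightarrow> nat"
  shows "word_weight t x k (map f [k..<n]) =
    t ^ card {(i, j). k \<le> i \<and> i < j \<and> j < n \<and> f i > f j} *
    (\<Prod>i\<in>{i. k \<le> i \<and> Suc i < n \<and> f i > f (Suc i)}. x i)"
proof (induction "n - k" arbitrary: k)
  case 0
  then have *: "{(i, j). k \<le> i \<and> i < j \<and> j < n \<and> f i > f j} = {}"
    "{i. k \<le> i \<and> Suc i < n \<and> f i > f (Suc i)} = {}" by auto
  show ?case using 0 unfolding * by simp
next
  case (Suc m)
  show ?case
  proof (cases "Suc k = n")
    case True
    then have *: "{(i, j). k \<le> i \<and> i < j \<and> j < n \<and> f i > f j} = {}"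
      "{i. k \<le> i \<and> Suc i < n \<and> f i > f (Suc i)} = {}" "[k..<n] = [k]" by auto
    show ?thesis unfolding * by simp
  next
    case False
    then have k: "Suc k < n" using Suc.hyps(2) by simp
    let ?I = "\<lambda>k. {(i, j). k \<le> i \<and> i < j \<and> j < n \<and> f i > f j}"
    let ?D = "\<lambda>k. {i. k \<le> i \<and> Suc i < n \<and> f i > f (Suc i)}"
    have fin: "finite (?I (Suc k))"
      by (rule finite_subset[of _ "{..n} \<times> {..n}"]) auto
    have IH: "word_weight t x (Suc k) (map f [Suc k..<n]) = t ^ card (?I (Suc k)) * prod x (?D (Suc k))"
      using Suc by (intro Suc.hyps(1)) simp
    have I: "?I k = Pair k ` {j. k < j \<and> j < n \<and> f k > f j} \<union> ?I (Suc k)"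
      by (auto simp: image_iff le_Suc_eq dest: le_neq_implies_less)
    have "card (?I k) = card (Pair k ` {j. k < j \<and> j < n \<and> f k > f j}) + card (?I (Suc k))"
      unfolding I by (rule card_Un_disjoint) (use fin in auto)
    also have "card (Pair k ` {j. k < j \<and> j < n \<and> f k > f j}) = card {j. k < j \<and> j < n \<and> f k > f j}"
      by (rule card_image) (auto simp: inj_on_def)
    also have "{j. k < j \<and> j < n \<and> f k > f j} = set (filter (\<lambda>j. f j < f k) [Suc k..<n])"
      by auto
    also have "card \<dots> = length (filter (\<lambda>c. c < f k) (map f [Suc k..<n]))"
      by (subst distinct_card) (auto simp: filter_map o_def)
    finally have cI: "card (?I k) =
      length (filter (\<lambda>c. c < f k) (map f [Suc k..<n])) + card (?I (Suc k))" .
    have D: "?D k = (if f (Suc k) < f k then insert k (?D (Suc k)) else ?D (Suc k))"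
      using k by (auto simp: le_Suc_eq dest: le_neq_implies_less)
    have finD: "finite (?D (Suc k))"
      by (rule finite_subset[of _ "{..n}"]) auto
    have pD: "prod x (?D k) = (if f (Suc k) < f k then x k else 1) * prod x (?D (Suc k))"
      unfolding D using finD by auto
    have "map f [k..<n] = f k # map f [Suc k..<n]"
      using k by (simp add: upt_conv_Cons)
    also have "word_weight t x k \<dots> =
      t ^ length (filter (\<lambda>c. c < f k) (map f [Suc k..<n])) *
      (if hd (map f [Suc k..<n]) < f k then x k else 1) * word_weight t x (Suc k) (map f [Suc k..<n])"
      using k by (intro word_weight_Cons) simp
    also have "hd (map f [Suc k..<n]) = f (Suc k)"
      using k by (simp add: upt_conv_Cons)
    finally show ?thesis
      unfolding cI pD IH by (simp only: power_add mult_ac)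
  qed
qed

subsection \<open>Words all of whose prefixes, or all of whose suffixes, are intervals\<close>

text \<open>The half-open form admits the empty set, which occurs as the prefix of length 0 and as
  any suffix past the end.\<close>

definition nat_interval :: "nat set \<Rightarrow> bool" where
  "nat_interval S \<longleftrightarrow> (\<exists>a b. S = {a..<b})"

text \<open>For the letters 1 to n these are the left-unimodal permutations in one-line notation.
  Reversal of words exchanges them with the suffix version below, but it does not preserve weights,
  so both sums have to be computed.\<close>

definition prefix_interval_words :: "nat \<Rightarrow> nat \<Rightarrow> nat list set" where
  "prefix_interval_words a b =
     {xs. distinct xs \<and> set xs = {a..<b} \<and> (\<forall>j. nat_interval (set (take j xs)))}"

definition suffix_interval_words :: "nat \<Rightarrow> nat \<Rightarrow> nat list set" where
  "suffix_interval_words a b =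
     {xs. distinct xs \<and> set xs = {a..<b} \<and> (\<forall>j. nat_interval (set (drop j xs)))}"

lemma nat_interval_atLeastLessThan [simp, intro]: "nat_interval {a..<b}"
  by (auto simp: nat_interval_def)

lemma nat_interval_empty [simp, intro]: "nat_interval {}"
  unfolding nat_interval_def by (rule exI[of _ 0], rule exI[of _ 0]) simp

lemma nat_interval_singleton [simp, intro]: "nat_interval {a}"
  unfolding nat_interval_def by (rule exI[of _ a], rule exI[of _ "Suc a"]) auto

lemma nat_interval_convex: "nat_interval S \<Longrightarrow> a \<in> S \<Longrightarrow> c \<in> S \<Longrightarrow> a \<le> b \<Longrightarrow> b \<le> c \<Longrightarrow> b \<in> S"
  by (auto simp: nat_interval_def)

text \<open>If \<open>z\<close> were an interior point, both endpoints would survive in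
  \<open>S\<close> and convexity would force \<open>z\<close> back into \<open>S\<close>. This is
  the source of the binary choice, minimum or maximum, behind every factor of the products.\<close>

lemma nat_interval_remove_endpoint:
  assumes "nat_interval S" "insert z S = {a..<b}" "z \<notin> S"
  shows "z = a \<and> S = {Suc a..<b} \<or> z = b - 1 \<and> S = {a..<b - 1}"
proof -
  have S: "S = {a..<b} - {z}" using assms by auto
  have z: "a \<le> z" "z < b" using assms by auto
  have "z = a \<or> z = b - 1"
  proof (rule ccontr)
    assume "\<not> ?thesis"
    then have "a \<in> S" "b - 1 \<in> S" using z S by auto
    then have "z \<in> S" using z nat_interval_convex[OF assms(1), of a "b - 1" z] by simp
    then show False using assms by simp
  qed
  then show ?thesis
  proof
    assume "z = a"
    then show ?thesis using z unfolding S by auto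
  next
    assume "z = b - 1"
    then show ?thesis using z unfolding S by auto
  qed
qed

lemma all_take_snoc:
  "(\<forall>j. P (set (take j (p @ [z])))) \<longleftrightarrow> (\<forall>j. P (set (take j p))) \<and> P (set (p @ [z]))"
  (is "?L \<longleftrightarrow> ?R")
proof
  assume L: ?L
  have "P (set (take j p))" for j
  proof (cases "j \<le> length p")
    case True
    then show ?thesis using L[rule_format, of j] by simp
  next
    case False
    then show ?thesis using L[rule_format, of "length p"] by simp
  qed
  moreover have "P (set (p @ [z]))" using L[rule_format, of "Suc (length p)"] by simp
  ultimately show ?R by blast
next
  assume R: ?R
  show ?L
  proof
    fix j
    show "P (set (take j (p @ [z])))"
    proof (cases "j \<le> length p")
      case True
      then show ?thesis using R[THEN conjunct1, rule_format, of j] by simp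
    next
      case False
      then have "take j (p @ [z]) = p @ [z]" by simp
      then show ?thesis using R by (simp only:)
    qed
  qed
qed

lemma all_drop_Cons:
  "(\<forall>j. P (set (drop j (z # s)))) \<longleftrightarrow> (\<forall>j. P (set (drop j s))) \<and> P (set (z # s))"
  (is "?L \<longleftrightarrow> ?R")
proof
  assume L: ?L
  have "P (set (drop j s))" for j using L[rule_format, of "Suc j"] by simp
  moreover have "P (set (z # s))" using L[rule_format, of 0] by simp
  ultimately show ?R by blast
next
  assume R: ?R
  show ?L
  proof
    fix j
    show "P (set (drop j (z # s)))"
      using R[THEN conjunct2] R[THEN conjunct1, rule_format, of "j - 1"] by (cases j) simp_all
  qed
qed

lemma finite_interval_words [simp, intro]:
  "finite (prefix_interval_words a b)" "finite (suffix_interval_words a b)"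
  unfolding prefix_interval_words_def suffix_interval_words_def
  by (rule finite_subset[OF _ finite_subset_distinct[of "{a..<b}"]]; force)+

lemma length_prefix_interval_words: "xs \<in> prefix_interval_words a b \<Longrightarrow> length xs = b - a"
  using distinct_card[of xs] by (simp add: prefix_interval_words_def)

lemma length_suffix_interval_words: "xs \<in> suffix_interval_words a b \<Longrightarrow> length xs = b - a"
  using distinct_card[of xs] by (simp add: suffix_interval_words_def)

lemma prefix_interval_words_singleton: "prefix_interval_words a (Suc a) = {[a]}"
proof -
  have "distinct xs \<and> set xs = {a} \<longleftrightarrow> xs = [a]" for xs
    by (cases xs; cases "tl xs") auto
  moreover have "nat_interval (set (take j [a]))" for j by (cases j) auto
  ultimately show ?thesis by (auto simp: prefix_interval_words_def)
qed

lemma suffix_interval_words_singleton: "suffix_interval_words a (Suc a) = {[a]}"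
proof -
  have "distinct xs \<and> set xs = {a} \<longleftrightarrow> xs = [a]" for xs
    by (cases xs; cases "tl xs") auto
  moreover have "nat_interval (set (drop j [a]))" for j by (cases j) auto
  ultimately show ?thesis by (auto simp: suffix_interval_words_def)
qed

text \<open>Removing the last letter leaves a prefix, hence an interval, so the last letter is the
  maximum or the minimum of the alphabet. The hypothesis makes the alphabet nonempty, which excludes
  the empty word.\<close>

lemma prefix_interval_words_Suc:
  assumes "a \<le> b"
  shows "prefix_interval_words a (Suc b) =
    (\<lambda>p. p @ [b]) ` prefix_interval_words a b \<union>
    (\<lambda>p. p @ [a]) ` prefix_interval_words (Suc a) (Suc b)" (is "?L = ?R")
proof (rule set_eqI)
  fix xs
  show "xs \<in> ?L \<longleftrightarrow> xs \<in> ?R"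
  proof (cases xs rule: rev_cases)
    case Nil
    then show ?thesis using assms by (auto simp: prefix_interval_words_def)
  next
    case (snoc p z)
    have "xs \<in> ?L \<longleftrightarrow> distinct p \<and> z \<notin> set p \<and> insert z (set p) = {a..<Suc b} \<and>
        (\<forall>j. nat_interval (set (take j p)))"
      unfolding prefix_interval_words_def snoc mem_Collect_eq all_take_snoc by auto
    also have "\<dots> \<longleftrightarrow> distinct p \<and> (\<forall>j. nat_interval (set (take j p))) \<and>
        (z = a \<and> set p = {Suc a..<Suc b} \<or> z = b \<and> set p = {a..<b})" (is "?A \<longleftrightarrow> ?B")
    proof
      assume A: ?A
      then have "nat_interval (set p)" by (metis take_all order_refl)
      from nat_interval_remove_endpoint[OF this, of z a "Suc b"] A show ?B by auto
    next
      assume ?B then show ?A using assms by auto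
    qed
    also have "\<dots> \<longleftrightarrow> xs \<in> ?R"
      using snoc by (auto simp: prefix_interval_words_def)
    finally show ?thesis .
  qed
qed

text \<open>The mirror image of the previous recursion: the first letter is now the one that must be
  an endpoint, since what follows it is a suffix.\<close>

lemma suffix_interval_words_Suc:
  assumes "a \<le> b"
  shows "suffix_interval_words a (Suc b) =
    (#) b ` suffix_interval_words a b \<union> (#) a ` suffix_interval_words (Suc a) (Suc b)" (is "?L = ?R")
proof (rule set_eqI)
  fix xs
  show "xs \<in> ?L \<longleftrightarrow> xs \<in> ?R"
  proof (cases xs)
    case Nil
    then show ?thesis using assms by (auto simp: suffix_interval_words_def)
  next
    case (Cons z p)
    have "xs \<in> ?L \<longleftrightarrow> distinct p \<and> z \<notin> set p \<and> insert z (set p) = {a..<Suc b} \<and>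
        (\<forall>j. nat_interval (set (drop j p)))"
      unfolding suffix_interval_words_def Cons mem_Collect_eq all_drop_Cons by auto
    also have "\<dots> \<longleftrightarrow> distinct p \<and> (\<forall>j. nat_interval (set (drop j p))) \<and>
        (z = a \<and> set p = {Suc a..<Suc b} \<or> z = b \<and> set p = {a..<b})" (is "?A \<longleftrightarrow> ?B")
    proof
      assume A: ?A
      then have "nat_interval (set p)" by (metis drop0)
      from nat_interval_remove_endpoint[OF this, of z a "Suc b"] A show ?B by auto
    next
      assume ?B then show ?A using assms by auto
    qed
    also have "\<dots> \<longleftrightarrow> xs \<in> ?R"
      using Cons by (auto simp: suffix_interval_words_def)
    finally show ?thesis .
  qed
qed

section \<open>Generating functions of the two kinds of interval words\<close>

text \<open>By induction on the length. A final maximum changes nothing; a final minimum is inverted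
  with all \<open>Suc m\<close> letters before it and creates a descent at position
  \<open>Suc m\<close>. The two shorter alphabets differ by a shift and have the same sum, because
  \<open>a\<close> is arbitrary in the induction.\<close>

lemma sum_prefix_interval_words:
  "(\<Sum>p\<in>prefix_interval_words a (a + Suc m). word_weight t x 1 p) = (\<Prod>i=1..m. 1 + t ^ i * x i)"
proof (induction m arbitrary: a)
  case 0
  then show ?case by (simp add: prefix_interval_words_singleton)
next
  case (Suc m)
  let ?A = "prefix_interval_words a (a + Suc m)"
  let ?B = "prefix_interval_words (Suc a) (a + Suc (Suc m))"
  have A: "word_weight t x 1 (p @ [a + Suc m]) = word_weight t x 1 p" if "p \<in> ?A" for p
  proof -
    have s: "set p = {a..<a + Suc m}" and l: "length p = Suc m"
      using that length_prefix_interval_words[OF that] by (auto simp: prefix_interval_words_def)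
    then have ne: "p \<noteq> []" by auto
    moreover have "last p < a + Suc m" using last_in_set[OF ne] s by auto
    moreover have "(\<Sum>c\<leftarrow>p. length (filter (\<lambda>b. b < c) [a + Suc m])) = (\<Sum>c\<leftarrow>p. 0)"
      using s by (intro arg_cong[where f = sum_list] map_cong) auto
    then have "(\<Sum>c\<leftarrow>p. length (filter (\<lambda>b. b < c) [a + Suc m])) = 0" by simp
    ultimately show ?thesis by (simp add: word_weight_append del: filter.simps sum_list_eq_0_iff)
  qed
  have B: "word_weight t x 1 (p @ [a]) = word_weight t x 1 p * (t ^ Suc m * x (Suc m))" if "p \<in> ?B" for p
  proof -
    have s: "set p = {Suc a..<a + Suc (Suc m)}" and l: "length p = Suc m"
      using that length_prefix_interval_words[OF that] by (auto simp: prefix_interval_words_def)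
    then have ne: "p \<noteq> []" by auto
    moreover have "a < last p" using last_in_set[OF ne] s by auto
    moreover have "(\<Sum>c\<leftarrow>p. length (filter (\<lambda>b. b < c) [a])) = (\<Sum>c\<leftarrow>p. 1)"
      using s by (intro arg_cong[where f = sum_list] map_cong) auto
    ultimately show ?thesis
      using l by (simp add: word_weight_append sum_list_triv mult.assoc)
  qed
  have "(\<Sum>p\<in>prefix_interval_words a (a + Suc (Suc m)). word_weight t x 1 p) =
      (\<Sum>p\<in>(\<lambda>p. p @ [a + Suc m]) ` ?A. word_weight t x 1 p) +
      (\<Sum>p\<in>(\<lambda>p. p @ [a]) ` ?B. word_weight t x 1 p)"
    using prefix_interval_words_Suc[of a "a + Suc m"]
    by (subst sum.union_disjoint[symmetric]) auto
  also have "\<dots> = (\<Sum>p\<in>?A. word_weight t x 1 p) + (\<Sum>p\<in>?B. word_weight t x 1 p * (t ^ Suc m * x (Suc m)))"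
    by (subst (1 2) sum.reindex) (auto simp: inj_on_def A[simplified] B[simplified])
  also have "\<dots> = (\<Prod>i=1..m. 1 + t ^ i * x i) * (1 + t ^ Suc m * x (Suc m))"
    using Suc.IH[of a] Suc.IH[of "Suc a"]
    by (simp only: sum_distrib_right[symmetric] add_Suc_shift distrib_left mult_1_right)
  also have "\<dots> = (\<Prod>i=1..Suc m. 1 + t ^ i * x i)" by simp
  finally show ?case .
qed

text \<open>Here the first letter is stripped, which moves the starting position, so
  \<open>k\<close> must vary in the induction. The letter at position \<open>i\<close> is followed
  by \<open>k + m - i\<close> letters: it is smaller than all of them and contributes 1, or larger
  than all of them and contributes the other term.\<close>

lemma sum_suffix_interval_words:
  "(\<Sum>p\<in>suffix_interval_words a (a + Suc m). word_weight t x k p) =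
     (\<Prod>i=k..<k+m. 1 + t ^ (k + m - i) * x i)"
proof (induction m arbitrary: a k)
  case 0
  then show ?case by (simp add: suffix_interval_words_singleton)
next
  case (Suc m)
  let ?A = "suffix_interval_words a (a + Suc m)"
  let ?B = "suffix_interval_words (Suc a) (a + Suc (Suc m))"
  let ?w = "word_weight t x (Suc k)"
  have A: "word_weight t x k ((a + Suc m) # p) = t ^ Suc m * x k * ?w p" if "p \<in> ?A" for p
  proof -
    have s: "set p = {a..<a + Suc m}" and l: "length p = Suc m"
      using that length_suffix_interval_words[OF that] by (auto simp: suffix_interval_words_def)
    then have ne: "p \<noteq> []" by auto
    moreover have "hd p < a + Suc m" using hd_in_set[OF ne] s by auto
    moreover have "filter (\<lambda>c. c < a + Suc m) p = p" using s by (auto simp: filter_id_conv)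
    ultimately show ?thesis using l by (simp add: word_weight_Cons)
  qed
  have B: "word_weight t x k (a # p) = ?w p" if "p \<in> ?B" for p
  proof -
    have s: "set p = {Suc a..<a + Suc (Suc m)}" and l: "length p = Suc m"
      using that length_suffix_interval_words[OF that] by (auto simp: suffix_interval_words_def)
    then have ne: "p \<noteq> []" by auto
    moreover have "a < hd p" using hd_in_set[OF ne] s by auto
    moreover have "filter (\<lambda>c. c < a) p = []" using s by (auto simp: filter_empty_conv)
    ultimately show ?thesis by (simp add: word_weight_Cons)
  qed
  have "(\<Sum>p\<in>suffix_interval_words a (a + Suc (Suc m)). word_weight t x k p) =
      (\<Sum>p\<in>(#) (a + Suc m) ` ?A. word_weight t x k p) + (\<Sum>p\<in>(#) a ` ?B. word_weight t x k p)"
    using suffix_interval_words_Suc[of a "a + Suc m"]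
    by (subst sum.union_disjoint[symmetric]) auto
  also have "\<dots> = (\<Sum>p\<in>?A. t ^ Suc m * x k * ?w p) + (\<Sum>p\<in>?B. ?w p)"
    by (subst (1 2) sum.reindex) (auto simp: A[simplified] B[simplified])
  also have "\<dots> = (1 + t ^ Suc m * x k) * (\<Prod>i=Suc k..<Suc k+m. 1 + t ^ (Suc k + m - i) * x i)"
    using Suc.IH[where a = a and k = "Suc k"] Suc.IH[where a = "Suc a" and k = "Suc k"]
    by (simp only: sum_distrib_left[symmetric] add_Suc_shift distrib_right mult_1_left add.commute)
  also have "\<dots> = (\<Prod>i=k..<k+Suc m. 1 + t ^ (k + Suc m - i) * x i)"
    by (subst (2) prod.atLeast_Suc_lessThan) (simp, simp only: add_Suc_shift diff_add_inverse)
  finally show ?case .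
qed

subsection \<open>Arc words\<close>

definition arc_words :: "nat \<Rightarrow> nat list set" where
  "arc_words n = {xs. distinct xs \<and> set xs = {1..n} \<and>
     (\<forall>j. 1 \<le> j \<and> j \<le> n \<longrightarrow> cyclic_interval n (set (take j xs)))}"

lemma set_take_map_upt: "j \<le> n \<Longrightarrow> set (take j (map f [1..<Suc n])) = f ` {1..j}"
  by (simp add: take_map take_upt atLeastLessThanSuc_atLeastAtMost del: upt_Suc)

text \<open>One-line notation. Nothing is lost outside \<open>{1..n}\<close>, where a permutation of
  that set is the identity.\<close>

lemma bij_betw_arc_words:
  "bij_betw (\<lambda>\<pi>. map \<pi> [1..<Suc n]) (arc_permutations n) (arc_words n)"
proof (rule bij_betw_imageI)
  show "inj_on (\<lambda>\<pi>. map \<pi> [1..<Suc n]) (arc_permutations n)"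
  proof (rule inj_onI, rule ext)
    fix \<pi> \<sigma> i
    assume *: "\<pi> \<in> arc_permutations n" "\<sigma> \<in> arc_permutations n"
      and "map \<pi> [1..<Suc n] = map \<sigma> [1..<Suc n]"
    then have "\<forall>i\<in>{1..n}. \<pi> i = \<sigma> i" by (simp only: map_eq_conv) auto
    then show "\<pi> i = \<sigma> i"
      using * by (cases "i \<in> {1..n}") (auto simp: arc_permutations_def permutes_def)
  qed
  show "(\<lambda>\<pi>. map \<pi> [1..<Suc n]) ` arc_permutations n = arc_words n"
  proof (intro equalityI subsetI)
    fix xs assume "xs \<in> (\<lambda>\<pi>. map \<pi> [1..<Suc n]) ` arc_permutations n"
    then obtain \<pi> where \<pi>: "\<pi> permutes {1..n}" "xs = map \<pi> [1..<Suc n]"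
      "\<And>j. 1 \<le> j \<Longrightarrow> j \<le> n \<Longrightarrow> cyclic_interval n (\<pi> ` {1..j})"
      by (auto simp: arc_permutations_def)
    have "distinct xs"
      unfolding \<pi>(2) distinct_map using permutes_inj_on[OF \<pi>(1)] by auto
    moreover have "set xs = {1..n}"
      using permutes_image[OF \<pi>(1)] unfolding \<pi>(2) by (simp add: atLeastLessThanSuc_atLeastAtMost del: upt_Suc)
    moreover have "cyclic_interval n (set (take j xs))" if "1 \<le> j" "j \<le> n" for j
      using \<pi>(3)[OF that] set_take_map_upt[OF that(2), of \<pi>] unfolding \<pi>(2) by (simp only:)
    ultimately show "xs \<in> arc_words n" by (simp add: arc_words_def)
  next
    fix xs assume xs: "xs \<in> arc_words n"
    \<comment> \<open>Positions count from 1 but list indices from 0; outside the range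
      \<open>permutes\<close> demands fixed points.\<close>
    define \<pi> where "\<pi> i = (if i \<in> {1..n} then xs ! (i - 1) else i)" for i
    have d: "distinct xs" "set xs = {1..n}" using xs by (auto simp: arc_words_def)
    have l: "length xs = n" using distinct_card[OF d(1)] d(2) by simp
    have m: "map \<pi> [1..<Suc n] = xs"
      by (rule nth_equalityI) (auto simp: l \<pi>_def simp del: upt_Suc)
    have "inj_on \<pi> {1..n}"
      using d(1) unfolding m[symmetric] distinct_map by (simp add: atLeastLessThanSuc_atLeastAtMost del: upt_Suc)
    moreover have "\<pi> ` {1..n} = {1..n}"
      using d(2) unfolding m[symmetric] by (simp add: atLeastLessThanSuc_atLeastAtMost del: upt_Suc)
    ultimately have "\<pi> permutes {1..n}"
      by (intro bij_imp_permutes) (auto simp: bij_betw_def \<pi>_def)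
    moreover have "cyclic_interval n (\<pi> ` {1..j})" if "1 \<le> j" "j \<le> n" for j
      using xs that set_take_map_upt[of j n \<pi>] unfolding m by (auto simp: arc_words_def)
    ultimately have "\<pi> \<in> arc_permutations n" by (simp add: arc_permutations_def)
    then show "xs \<in> (\<lambda>\<pi>. map \<pi> [1..<Suc n]) ` arc_permutations n" using m by (metis image_eqI)
  qed
qed

lemma word_weight_permutation:
  "word_weight t x 1 (map \<pi> [1..<Suc n]) = t ^ inversions n \<pi> * (\<Prod>i\<in>descents n \<pi>. x i)"
proof -
  have "{(i, j). 1 \<le> i \<and> i < j \<and> j < Suc n \<and> \<pi> i > \<pi> j} =
      {(i, j). 1 \<le> i \<and> i < j \<and> j \<le> n \<and> \<pi> i > \<pi> j}"
    "{i. 1 \<le> i \<and> Suc i < Suc n \<and> \<pi> i > \<pi> (Suc i)} = {i. 1 \<le> i \<and> i < n \<and> \<pi> i > \<pi> (i + 1)}"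
    by auto
  then show ?thesis unfolding word_weight_map_upt inversions_def descents_def by (simp only:)
qed

section \<open>Cyclic intervals versus intervals of integers\<close>

lemma cyclic_interval_nat_interval:
  assumes "nat_interval S" "S \<noteq> {}" "S \<subseteq> {1..n}"
  shows "cyclic_interval n S"
proof -
  obtain a b where ab: "S = {a..<b}" using assms(1) by (auto simp: nat_interval_def)
  then have "a < b" using assms(2) by simp
  then have "a \<in> S" "b - 1 \<in> S" using ab by auto
  then have "1 \<le> a" "b - 1 \<le> n" using assms(3) by auto
  moreover have "S = {a..b - 1}" "a \<le> b - 1" using ab \<open>a < b\<close> by auto
  ultimately show ?thesis unfolding cyclic_interval_def by blast
qed

lemma cyclic_interval_complement:
  assumes "nat_interval R" "R \<subseteq> {1<..<n}" "1 \<le> n"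
  shows "cyclic_interval n ({1..n} - R)"
proof (cases "R = {}")
  case True
  then show ?thesis using assms(3) by (intro cyclic_interval_nat_interval)
    (simp_all flip: atLeastLessThanSuc_atLeastAtMost)
next
  case False
  obtain a b where ab: "R = {a..<b}" using assms(1) by (auto simp: nat_interval_def)
  then have "a < b" using False by simp
  then have "a \<in> R" "b - 1 \<in> R" using ab by auto
  then have "1 < a" "b - 1 < n" using assms(2) by auto
  then have "1 \<le> a - 1" "a - 1 \<le> b" "b \<le> n" "{1..n} - R = {b..n} \<union> {1..a - 1}"
    using \<open>a < b\<close> unfolding ab by auto
  then show ?thesis unfolding cyclic_interval_def by blast
qed

text \<open>If the two arcs touched or overlapped, \<open>S\<close> would be all of
  \<open>{1..n}\<close> and thus an interval. Hence the letter \<open>Suc a\<close> is really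
  missing, which is what later arguments exploit.\<close>

lemma cyclic_interval_wrap:
  assumes "cyclic_interval n S" "\<not> nat_interval S"
  obtains a b where "1 \<le> a" "Suc a < b" "b \<le> n" "S = {b..n} \<union> {1..a}"
proof -
  obtain a b where ab: "1 \<le> a" "a \<le> b" "b \<le> n" "S = {a..b} \<or> S = {b..n} \<union> {1..a}"
    using assms(1) by (auto simp: cyclic_interval_def)
  have S: "S = {b..n} \<union> {1..a}"
    using ab(4) assms(2) by (auto simp flip: atLeastLessThanSuc_atLeastAtMost)
  have "Suc a < b"
  proof (rule ccontr)
    assume "\<not> Suc a < b"
    then have "S = {1..<Suc n}" unfolding S using ab(1-3) by auto
    then show False using assms(2) by simp
  qed
  with ab S show thesis using that by blast
qed

text \<open>Once a prefix contains both 1 and \<open>n\<close>, the letters not yet used form an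
  interval of integers. This turns the rest of a wrapping word into a suffix interval word.\<close>

lemma nat_interval_complement_cyclic:
  assumes "cyclic_interval n S" "1 \<in> S" "n \<in> S"
  shows "nat_interval ({1..n} - S)"
proof -
  obtain a b where ab: "1 \<le> a" "a \<le> b" "b \<le> n" "S = {a..b} \<or> S = {b..n} \<union> {1..a}"
    using assms(1) by (auto simp: cyclic_interval_def)
  from ab(4) show ?thesis
  proof
    assume "S = {a..b}"
    then have "{1..n} - S = {}" using assms(2,3) by auto
    then show ?thesis by (simp only: nat_interval_empty)
  next
    assume "S = {b..n} \<union> {1..a}"
    then have "{1..n} - S = {Suc a..<b}" using ab by auto
    then show ?thesis by simp
  qed
qed

section \<open>Arc words sorted by their first wrapping prefix\<close>

definition wrapping_arc_words :: "nat \<Rightarrow> nat \<Rightarrow> nat list set" where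
  "wrapping_arc_words n j =
     {xs \<in> arc_words n. (\<forall>i\<le>j. nat_interval (set (take i xs))) \<and>
        \<not> nat_interval (set (take (Suc j) xs))}"

lemma finite_wrapping_arc_words: "finite (wrapping_arc_words n j)"
  by (rule finite_subset[OF _ finite_subset_distinct[of "{1..n}"]])
    (auto simp: wrapping_arc_words_def arc_words_def)

lemma length_arc_words: "xs \<in> arc_words n \<Longrightarrow> length xs = n"
  using distinct_card[of xs] by (simp add: arc_words_def)

text \<open>Take the least \<open>i\<close> whose prefix is not an interval, if there is one. Empty
  sets, singletons and the full set are intervals, so \<open>i\<close> is at least 2 and less than
  \<open>n\<close>; this gives the range of \<open>j = i - 1\<close>.\<close>

lemma arc_words_decompose:
  assumes "1 \<le> n"
  shows "arc_words n = prefix_interval_words 1 (Suc n) \<union> (\<Union>j\<in>{1..n - 2}. wrapping_arc_words n j)"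
    (is "_ = ?P \<union> ?W")
proof (intro equalityI subsetI)
  fix xs assume xs: "xs \<in> arc_words n"
  show "xs \<in> ?P \<union> ?W"
  proof (cases "\<forall>j. nat_interval (set (take j xs))")
    case True
    then show ?thesis using xs
      by (simp add: arc_words_def prefix_interval_words_def atLeastLessThanSuc_atLeastAtMost)
  next
    case False
    define i where "i = (LEAST i. \<not> nat_interval (set (take i xs)))"
    have i: "\<not> nat_interval (set (take i xs))"
      unfolding i_def using False by (metis (mono_tags, lifting) LeastI)
    have min: "nat_interval (set (take k xs))" if "k < i" for k
      using that not_less_Least[of k "\<lambda>i. \<not> nat_interval (set (take i xs))"] unfolding i_def by blast
    have "i \<noteq> 0" using i by (intro notI) simp
    moreover have "i \<noteq> 1"
    proof
      assume "i = 1"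
      then show False using i by (cases xs) auto
    qed
    moreover have "i < n"
    proof (rule ccontr)
      assume "\<not> i < n"
      then have "set (take i xs) = {1..<Suc n}"
        using xs length_arc_words[OF xs] by (auto simp: arc_words_def)
      then show False using i by simp
    qed
    ultimately obtain j where j: "i = Suc j" "1 \<le> j" "j \<le> n - 2"
      by (cases i) auto
    then have "xs \<in> wrapping_arc_words n j"
      using xs i min by (auto simp: wrapping_arc_words_def less_Suc_eq_le)
    then show ?thesis using j by auto
  qed
next
  fix xs assume "xs \<in> ?P \<union> ?W"
  then show "xs \<in> arc_words n"
  proof
    assume xs: "xs \<in> ?P"
    have l: "length xs = n" using length_prefix_interval_words[OF xs] by simp
    have s: "set xs = {1..n}"
      using xs by (simp add: prefix_interval_words_def atLeastLessThanSuc_atLeastAtMost)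
    have "cyclic_interval n (set (take j xs))" if "1 \<le> j" "j \<le> n" for j
    proof (rule cyclic_interval_nat_interval)
      show "nat_interval (set (take j xs))" using xs by (simp add: prefix_interval_words_def)
      show "set (take j xs) \<noteq> {}" using that l by auto
      show "set (take j xs) \<subseteq> {1..n}" using set_take_subset[of j xs] s by simp
    qed
    then show ?thesis using xs s by (simp add: prefix_interval_words_def arc_words_def)
  qed (auto simp: wrapping_arc_words_def)
qed

lemma set_drop_distinct: "distinct xs \<Longrightarrow> set (drop j xs) = set xs - set (take j xs)"
  using set_take_disj_set_drop_if_distinct[of xs j j] set_append[of "take j xs" "drop j xs"]
  by auto

text \<open>Common check for both families: \<open>z = n\<close> after the smallest letters and
  \<open>z = 1\<close> after the largest ones. Prefixes up to length \<open>j\<close> are intervals;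
  longer ones are complements of suffixes of \<open>s\<close>, whose letters lie strictly between 1
  and \<open>n\<close>.\<close>

lemma wrapping_arc_wordsI:
  assumes p: "p \<in> prefix_interval_words a b" and s: "s \<in> suffix_interval_words c d"
    and ab: "a + j = b" and cd: "c < d" and z: "z \<notin> {a..<b}" "z \<notin> {c..<d}"
    and disj: "{a..<b} \<inter> {c..<d} = {}"
    and un: "insert z ({a..<b} \<union> {c..<d}) = {1..n}"
    and ends: "1 \<in> insert z {a..<b}" "n \<in> insert z {a..<b}"
  shows "p @ z # s \<in> wrapping_arc_words n j"
proof -
  let ?xs = "p @ z # s"
  have lp: "length p = j" using length_prefix_interval_words[OF p] ab by simp
  have sp: "set p = {a..<b}" and ss: "set s = {c..<d}"
    using p s by (simp_all add: prefix_interval_words_def suffix_interval_words_def)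
  have d: "distinct ?xs"
    using p s z disj by (auto simp: prefix_interval_words_def suffix_interval_words_def)
  have sx: "set ?xs = {1..n}" using un sp ss by simp
  have "z \<in> {1..n}" using un by blast
  then have n: "1 \<le> n" by simp
  have low: "nat_interval (set (take i ?xs))" if "i \<le> j" for i
    using that p lp by (simp add: prefix_interval_words_def)
  have R: "{c..<d} \<subseteq> {1<..<n}"
  proof
    fix i assume i: "i \<in> {c..<d}"
    have "i \<in> {1..n}" using un i by blast
    moreover have "i \<notin> insert z {a..<b}" using z disj i by blast
    then have "i \<noteq> 1" "i \<noteq> n" using ends by blast+
    ultimately show "i \<in> {1<..<n}" by auto
  qed
  have "cyclic_interval n (set (take i ?xs))" if i: "1 \<le> i" "i \<le> n" for i
  proof (cases "i \<le> j")
    case True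
    show ?thesis
    proof (rule cyclic_interval_nat_interval[OF low[OF True]])
      show "set (take i ?xs) \<noteq> {}" using i by auto
      show "set (take i ?xs) \<subseteq> {1..n}" using set_take_subset[of i ?xs] sx by simp
    qed
  next
    case False
    then have "drop i ?xs = drop (i - Suc j) s" using lp by (simp add: drop_Cons')
    then have *: "nat_interval (set (drop i ?xs))" "set (drop i ?xs) \<subseteq> {c..<d}"
      using s set_drop_subset[of "i - Suc j" s] ss by (auto simp: suffix_interval_words_def)
    have "set (take i ?xs) = {1..n} - set (drop i ?xs)"
      using set_drop_distinct[OF d, of i] set_take_subset[of i ?xs] sx by auto
    then show ?thesis
      using cyclic_interval_complement[OF *(1) subset_trans[OF *(2) R] n] by (simp only:)
  qed
  moreover have "\<not> nat_interval (set (take (Suc j) ?xs))"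
  proof
    assume *: "nat_interval (set (take (Suc j) ?xs))"
    have "take (Suc j) ?xs = p @ [z]" using lp by simp
    then have st: "set (take (Suc j) ?xs) = insert z {a..<b}" using sp by simp
    \<comment> \<open>The letter \<open>c\<close> of \<open>s\<close> lies between 1 and
      \<open>n\<close>, both already used by \<open>p @ [z]\<close>, so convexity would place
      \<open>c\<close> there too.\<close>
    have "c \<in> {1<..<n}" using R cd by auto
    then have "c \<in> insert z {a..<b}"
      using nat_interval_convex[OF *, of 1 n c] ends unfolding st by auto
    moreover have "c \<in> {c..<d}" using cd by simp
    ultimately show False using z disj by blast
  qed
  ultimately show ?thesis
    using low d sx by (auto simp: wrapping_arc_words_def arc_words_def)
qed

text \<open>The prefix of length \<open>Suc j\<close> consists of two arcs separated by a gap.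
  Without its last letter \<open>z\<close> it is an interval, so it lies on one side of the gap and
  \<open>z\<close> alone is the other arc. Hence \<open>z\<close> is 1 or \<open>n\<close>, and the
  length \<open>j\<close> determines the letters of \<open>p\<close>.\<close>

lemma wrapping_arc_words_eq:
  assumes j: "1 \<le> j" "j \<le> n - 2"
  shows "wrapping_arc_words n j =
    (\<lambda>(p, s). p @ n # s) ` (prefix_interval_words 1 (Suc j) \<times> suffix_interval_words (Suc j) n) \<union>
    (\<lambda>(p, s). p @ 1 # s) `
      (prefix_interval_words (Suc (n - j)) (Suc n) \<times> suffix_interval_words 2 (Suc (n - j)))"
    (is "_ = ?f n ` ?A \<union> ?f 1 ` ?B")
proof (intro equalityI subsetI)
  fix xs assume xs: "xs \<in> wrapping_arc_words n j"
  then have arc: "xs \<in> arc_words n" by (simp add: wrapping_arc_words_def)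
  have d: "distinct xs" and sx: "set xs = {1..n}" using arc by (simp_all add: arc_words_def)
  have l: "length xs = n" by (rule length_arc_words[OF arc])
  define p z s where "p = take j xs" and "z = xs ! j" and "s = drop (Suc j) xs"
  have jn: "Suc j < n" using j by simp
  have xs_eq: "xs = p @ z # s" using jn l by (simp add: p_def z_def s_def id_take_nth_drop)
  have tk: "take (Suc j) xs = p @ [z]" using jn l by (simp add: p_def z_def take_Suc_conv_app_nth)
  have zp: "z \<notin> set p" using d xs_eq by simp
  have cp: "card (set p) = j" using d jn l by (simp add: distinct_card p_def)
  have p_int: "nat_interval (set p)" using xs by (simp add: wrapping_arc_words_def p_def)
  have cyc: "cyclic_interval n (set (take i xs))" if "1 \<le> i" "i \<le> n" for i
    using arc that by (simp add: arc_words_def)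
  obtain a b where ab: "1 \<le> a" "Suc a < b" "b \<le> n" "set (take (Suc j) xs) = {b..n} \<union> {1..a}"
    using cyclic_interval_wrap[OF cyc[of "Suc j"]] xs jn by (auto simp: wrapping_arc_words_def)
  have S: "insert z (set p) = {b..n} \<union> {1..a}" using ab(4) tk by simp
  have p_eq: "set p = {b..n} \<union> {1..a} - {z}" using S zp by auto
  \<comment> \<open>The interval \<open>set p\<close> misses \<open>Suc a\<close>, so it cannot have
    letters on both sides of it.\<close>
  have gap: "\<not> (u \<in> set p \<and> v \<in> set p \<and> u \<le> Suc a \<and> Suc a \<le> v)" for u v
  proof
    assume "u \<in> set p \<and> v \<in> set p \<and> u \<le> Suc a \<and> Suc a \<le> v"
    then have "Suc a \<in> set p" using nat_interval_convex[OF p_int, of u v "Suc a"] by blast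
    then show False using p_eq ab by auto
  qed
  have s_set: "set s = {Suc a..<b} "
  proof -
    have "set s = {1..n} - ({b..n} \<union> {1..a})"
      using set_drop_distinct[OF d, of "Suc j"] sx ab(4) by (simp add: s_def)
    also have "\<dots> = {Suc a..<b}" using ab by auto
    finally show ?thesis .
  qed
  \<comment> \<open>The letters left after a prefix of length at least \<open>Suc j\<close>, which
    contains 1 and \<open>n\<close>; past the end of the word nothing is left.\<close>
  have s_int: "nat_interval (set (drop i s))" for i
  proof (cases "Suc j + i \<le> n")
    case True
    have "set (take (Suc j) xs) \<subseteq> set (take (Suc j + i) xs)"
      by (rule set_take_subset_set_take) simp
    then have "1 \<in> set (take (Suc j + i) xs)" "n \<in> set (take (Suc j + i) xs)"
      using ab by auto
    then have "nat_interval ({1..n} - set (take (Suc j + i) xs))"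
      by (intro nat_interval_complement_cyclic cyc) (use True in auto)
    moreover have "set (drop i s) = {1..n} - set (take (Suc j + i) xs)"
      using set_drop_distinct[OF d, of "Suc j + i"] sx by (simp add: s_def add.commute)
    ultimately show ?thesis by simp
  next
    case False
    then have "drop i s = []" using l by (simp add: s_def)
    then show ?thesis by simp
  qed
  have p_prefix: "\<forall>i. nat_interval (set (take i p))"
    using xs by (simp add: wrapping_arc_words_def p_def min_def)
  have dp: "distinct p" "distinct s" using d by (simp_all add: p_def s_def)
  \<comment> \<open>Otherwise 1 and \<open>n\<close> would both lie in \<open>p\<close>, on opposite
    sides of the gap.\<close>
  have "z = 1 \<or> z = n"
    using gap[of 1 n] ab p_eq by auto
  then show "xs \<in> ?f n ` ?A \<union> ?f 1 ` ?B"
  proof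
    assume z: "z = n"
    have "b = n"
      using gap[of 1 b] ab p_eq z by auto
    then have "set p = {1..<Suc a}" unfolding p_eq z using ab by auto
    then have "set p = {1..<Suc j}" "a = j" using cp by auto
    then have "(p, s) \<in> ?A"
      using dp p_prefix s_int s_set \<open>b = n\<close>
      by (simp add: prefix_interval_words_def suffix_interval_words_def)
    then show ?thesis using xs_eq z by (intro UnI1 image_eqI[of _ _ "(p, s)"]) auto
  next
    assume z: "z = 1"
    have "a = 1"
      using gap[of a n] ab p_eq z by auto
    then have "set p = {b..<Suc n}" unfolding p_eq z using ab by auto
    moreover from this have "b = Suc (n - j)" using cp ab by auto
    ultimately have "(p, s) \<in> ?B"
      using dp p_prefix s_int s_set \<open>a = 1\<close>
      by (simp add: prefix_interval_words_def suffix_interval_words_def numeral_2_eq_2)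
    then show ?thesis using xs_eq z by (intro UnI2 image_eqI[of _ _ "(p, s)"]) auto
  qed
next
  fix xs assume "xs \<in> ?f n ` ?A \<union> ?f 1 ` ?B"
  then show "xs \<in> wrapping_arc_words n j"
  proof
    assume "xs \<in> ?f n ` ?A"
    then obtain p s where ps: "p \<in> prefix_interval_words 1 (Suc j)"
      "s \<in> suffix_interval_words (Suc j) n" and xs: "xs = p @ n # s" by auto
    show ?thesis unfolding xs
      by (rule wrapping_arc_wordsI[OF ps]) (use j in auto)
  next
    assume "xs \<in> ?f 1 ` ?B"
    then obtain p s where ps: "p \<in> prefix_interval_words (Suc (n - j)) (Suc n)"
      "s \<in> suffix_interval_words 2 (Suc (n - j))" and xs: "xs = p @ 1 # s" by auto
    show ?thesis unfolding xs
      by (rule wrapping_arc_wordsI[OF ps]) (use j in auto)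
  qed
qed

section \<open>Weights of wrapping words\<close>

text \<open>The common length \<open>j\<close> of the first parts makes the splitting of a word
  unique, so the map is injective and the sum becomes a double sum.\<close>

lemma sum_append_Cons_image:
  assumes "\<And>p. p \<in> P \<Longrightarrow> length p = j"
  shows "(\<Sum>xs\<in>(\<lambda>(p, s). p @ z # s) ` (P \<times> S). f xs) = (\<Sum>p\<in>P. \<Sum>s\<in>S. f (p @ z # s))"
proof -
  have "inj_on (\<lambda>(p, s). p @ z # s) (P \<times> S)"
    using assms by (auto simp: inj_on_def)
  then show ?thesis
    by (subst sum.reindex) (simp_all add: sum.cartesian_product case_prod_beta o_def)
qed

lemma sum_product_scaled:
  fixes c :: "'a::comm_semiring_1"
  shows "(\<Sum>p\<in>P. \<Sum>s\<in>S. f p * (c * g s)) = sum f P * (c * sum g S)"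
  by (simp only: sum_distrib_left[symmetric] sum_distrib_right[symmetric])

text \<open>The letters of \<open>p\<close> are below everything that follows, so they add no
  crossing inversions. The letter \<open>n\<close>, at position \<open>j + 1\<close>, is inverted
  with all \<open>n - j - 1\<close> letters of \<open>s\<close> and starts a descent.\<close>

lemma word_weight_max_between:
  assumes p: "p \<in> prefix_interval_words 1 (Suc j)" and s: "s \<in> suffix_interval_words (Suc j) n"
    and j: "1 \<le> j" "Suc j < n"
  shows "word_weight t x 1 (p @ n # s) =
    word_weight t x 1 p * (t ^ (n - j - 1) * x (j + 1) * word_weight t x (j + 2) s)"
proof -
  have lp: "length p = j" and ls: "length s = n - Suc j"
    using length_prefix_interval_words[OF p] length_suffix_interval_words[OF s] by auto
  have sp: "set p = {1..<Suc j}" and ss: "set s = {Suc j..<n}"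
    using p s by (simp_all add: prefix_interval_words_def suffix_interval_words_def)
  have ne: "p \<noteq> []" "s \<noteq> []" using lp ls j by auto
  have "(\<Sum>a\<leftarrow>p. length (filter (\<lambda>c. c < a) (n # s))) = (\<Sum>a\<leftarrow>p. 0)"
    using sp ss j by (intro arg_cong[where f = sum_list] map_cong) (auto simp: filter_empty_conv)
  then have "(\<Sum>a\<leftarrow>p. length (filter (\<lambda>c. c < a) (n # s))) = 0" by simp
  moreover have "last p < n" using last_in_set[OF ne(1)] sp j by auto
  moreover have "hd s < n" using hd_in_set[OF ne(2)] ss by auto
  moreover have "filter (\<lambda>c. c < n) s = s" using ss by (auto simp: filter_id_conv)
  ultimately show ?thesis
    using ne lp ls by (simp add: word_weight_append word_weight_Cons del: filter.simps sum_list_eq_0_iff)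
qed

text \<open>Each of the \<open>j\<close> letters of \<open>p\<close> exceeds each of the
  \<open>n - j\<close> letters after it, and the step down to 1 is a descent at \<open>j\<close>.
  The letter 1 itself contributes nothing further.\<close>

lemma word_weight_min_between:
  assumes p: "p \<in> prefix_interval_words (Suc (n - j)) (Suc n)"
    and s: "s \<in> suffix_interval_words 2 (Suc (n - j))"
    and j: "1 \<le> j" "Suc j < n"
  shows "word_weight t x 1 (p @ 1 # s) =
    word_weight t x 1 p * (t ^ (j * (n - j)) * x j * word_weight t x (j + 2) s)"
proof -
  have lp: "length p = j" and ls: "length s = n - Suc j"
    using length_prefix_interval_words[OF p] length_suffix_interval_words[OF s] j by auto
  have sp: "set p = {Suc (n - j)..<Suc n}" and ss: "set s = {2..<Suc (n - j)}"
    using p s by (simp_all add: prefix_interval_words_def suffix_interval_words_def)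
  have ne: "p \<noteq> []" "s \<noteq> []" using lp ls j by auto
  have "(\<Sum>a\<leftarrow>p. length (filter (\<lambda>c. c < a) (1 # s))) = (\<Sum>a\<leftarrow>p. n - j)"
  proof (intro arg_cong[where f = sum_list] map_cong refl)
    fix a assume "a \<in> set p"
    then have "\<forall>c\<in>set (1 # s). c < a" using sp ss j by auto
    then have "filter (\<lambda>c. c < a) (1 # s) = 1 # s" by (simp add: filter_id_conv)
    then show "length (filter (\<lambda>c. c < a) (1 # s)) = n - j" using ls j by simp
  qed
  then have "(\<Sum>a\<leftarrow>p. length (filter (\<lambda>c. c < a) (1 # s))) = j * (n - j)"
    using lp by (simp add: sum_list_triv)
  moreover have "1 < last p" using last_in_set[OF ne(1)] sp j by auto
  moreover have "\<not> hd s < 1" using hd_in_set[OF ne(2)] ss by auto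
  moreover have "filter (\<lambda>c. c < 1) s = []" using ss by (auto simp: filter_empty_conv)
  ultimately show ?thesis
    using ne lp by (simp add: word_weight_append word_weight_Cons mult_ac)
qed

text \<open>The sums over \<open>p\<close> and \<open>s\<close> depend only on lengths and starting
  positions, not on the alphabets. Both families therefore share the same two products, and only
  their middle monomials are added.\<close>

lemma sum_wrapping_arc_words:
  assumes j: "1 \<le> j" "j \<le> n - 2"
  shows "(\<Sum>xs\<in>wrapping_arc_words n j. word_weight t x 1 xs) =
    (t ^ (j * (n - j)) * x j + t ^ (n - j - 1) * x (j + 1)) *
    (\<Prod>i=1..j-1. 1 + t ^ i * x i) * (\<Prod>i=j+2..n-1. 1 + t ^ (n - i) * x i)"
proof -
  let ?w = "word_weight t x"
  let ?P = "\<Prod>i=1..j-1. 1 + t ^ i * x i" and ?S = "\<Prod>i=j+2..n-1. 1 + t ^ (n - i) * x i"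
  let ?A = "prefix_interval_words 1 (Suc j)" and ?A' = "suffix_interval_words (Suc j) n"
  let ?B = "prefix_interval_words (Suc (n - j)) (Suc n)" and ?B' = "suffix_interval_words 2 (Suc (n - j))"
  let ?f = "\<lambda>z (p, s). p @ z # s"
  have jn: "Suc j < n" using j by simp
  have lA: "length p = j" if "p \<in> ?A" for p using length_prefix_interval_words[OF that] by simp
  have lB: "length p = j" if "p \<in> ?B" for p using length_prefix_interval_words[OF that] jn by simp
  have P: "(\<Sum>p\<in>?A. ?w 1 p) = ?P" "(\<Sum>p\<in>?B. ?w 1 p) = ?P"
    using sum_prefix_interval_words[of t x 1 "j - 1"] sum_prefix_interval_words[of t x "Suc (n - j)" "j - 1"]
      j jn by simp_all
  \<comment> \<open>With \<open>k = j + 2\<close> and \<open>m = n - j - 2\<close> in the suffix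
    formula, \<open>k + m\<close> is \<open>n\<close>, so its exponents become
    \<open>n - i\<close>.\<close>
  have idx: "{j + 2..<n} = {j + 2..n - 1}" and top: "j + 2 + (n - j - 2) = n" using jn by auto
  have S: "(\<Sum>s\<in>?A'. ?w (j + 2) s) = ?S" "(\<Sum>s\<in>?B'. ?w (j + 2) s) = ?S"
    using sum_suffix_interval_words[of t x "j + 2" "Suc j" "n - j - 2"]
      sum_suffix_interval_words[of t x "j + 2" 2 "n - j - 2"] jn
    unfolding top idx by (simp_all add: Suc_diff_Suc)
  have nth: "(p @ z # s) ! j = z" if "length p = j" for p s and z :: nat using that by auto
  \<comment> \<open>The letter at index \<open>j\<close> tells the families apart: it is
    \<open>n\<close> in one and 1 in the other.\<close>
  have "?f n ` (?A \<times> ?A') \<inter> ?f 1 ` (?B \<times> ?B') = {}"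
  proof (rule equals0I)
    fix xs assume "xs \<in> ?f n ` (?A \<times> ?A') \<inter> ?f 1 ` (?B \<times> ?B')"
    then have "xs ! j = n" "xs ! j = 1" using lA lB by (auto simp: nth)
    then show False using jn by simp
  qed
  then have "(\<Sum>xs\<in>wrapping_arc_words n j. ?w 1 xs) =
      (\<Sum>xs\<in>?f n ` (?A \<times> ?A'). ?w 1 xs) + (\<Sum>xs\<in>?f 1 ` (?B \<times> ?B'). ?w 1 xs)"
    unfolding wrapping_arc_words_eq[OF j] by (intro sum.union_disjoint) auto
  also have "(\<Sum>xs\<in>?f n ` (?A \<times> ?A'). ?w 1 xs) = (\<Sum>p\<in>?A. \<Sum>s\<in>?A'. ?w 1 (p @ n # s))"
    by (rule sum_append_Cons_image[OF lA])
  also have "\<dots> = (\<Sum>p\<in>?A. \<Sum>s\<in>?A'. ?w 1 p * (t ^ (n - j - 1) * x (j + 1) * ?w (j + 2) s))"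
    by (intro sum.cong refl word_weight_max_between j(1) jn)
  also have "\<dots> = ?P * (t ^ (n - j - 1) * x (j + 1) * ?S)"
    by (simp only: sum_product_scaled P S)
  also have "(\<Sum>xs\<in>?f 1 ` (?B \<times> ?B'). ?w 1 xs) = (\<Sum>p\<in>?B. \<Sum>s\<in>?B'. ?w 1 (p @ 1 # s))"
    by (rule sum_append_Cons_image[OF lB])
  also have "\<dots> = (\<Sum>p\<in>?B. \<Sum>s\<in>?B'. ?w 1 p * (t ^ (j * (n - j)) * x j * ?w (j + 2) s))"
    by (intro sum.cong refl word_weight_min_between j(1) jn)
  also have "\<dots> = ?P * (t ^ (j * (n - j)) * x j * ?S)"
    by (simp only: sum_product_scaled P S)
  finally show ?thesis by (simp add: algebra_simps)
qed

section \<open>Assembling the generating function\<close>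

text \<open>The identity holds for arbitrary elements \<open>t\<close> and \<open>x i\<close> of a
  commutative semiring; the polynomial ring enters only in the final theorem.\<close>

lemma sum_arc_words:
  assumes "1 \<le> n"
  shows "(\<Sum>xs\<in>arc_words n. word_weight t x 1 xs) =
    (\<Prod>i=1..n-1. 1 + t ^ i * x i) +
    (\<Sum>j=1..n-2. (t ^ (j * (n - j)) * x j + t ^ (n - j - 1) * x (j + 1)) *
       (\<Prod>i=1..j-1. 1 + t ^ i * x i) * (\<Prod>i=j+2..n-1. 1 + t ^ (n - i) * x i))"
proof -
  let ?w = "word_weight t x 1"
  let ?P = "prefix_interval_words 1 (Suc n)" and ?W = "wrapping_arc_words n"
  have "?P \<inter> (\<Union>j\<in>{1..n - 2}. ?W j) = {}"
    by (auto simp: prefix_interval_words_def wrapping_arc_words_def)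
  then have "(\<Sum>xs\<in>arc_words n. ?w xs) = (\<Sum>xs\<in>?P. ?w xs) + (\<Sum>xs\<in>(\<Union>j\<in>{1..n - 2}. ?W j). ?w xs)"
    unfolding arc_words_decompose[OF assms]
    by (intro sum.union_disjoint) (auto simp: finite_wrapping_arc_words)
  also have "(\<Sum>xs\<in>(\<Union>j\<in>{1..n - 2}. ?W j). ?w xs) = (\<Sum>j=1..n-2. \<Sum>xs\<in>?W j. ?w xs)"
  proof (rule sum.UNION_disjoint)
    \<comment> \<open>The prefix of length \<open>Suc i\<close>, which is at most \<open>j\<close>,
      is an interval for words in \<open>?W j\<close> but not for words in
      \<open>?W i\<close>.\<close>
    have "?W i \<inter> ?W j = {}" if "i < j" for i j
      using that by (auto simp: wrapping_arc_words_def)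
    then show "\<forall>i\<in>{1..n - 2}. \<forall>j\<in>{1..n - 2}. i \<noteq> j \<longrightarrow> ?W i \<inter> ?W j = {}"
      by (auto simp: neq_iff Int_commute)
  qed (auto simp: finite_wrapping_arc_words)
  also have "(\<Sum>xs\<in>?P. ?w xs) = (\<Prod>i=1..n-1. 1 + t ^ i * x i)"
    using sum_prefix_interval_words[of t x 1 "n - 1"] assms by simp
  also have "(\<Sum>j=1..n-2. \<Sum>xs\<in>?W j. ?w xs) =
    (\<Sum>j=1..n-2. (t ^ (j * (n - j)) * x j + t ^ (n - j - 1) * x (j + 1)) *
       (\<Prod>i=1..j-1. 1 + t ^ i * x i) * (\<Prod>i=j+2..n-1. 1 + t ^ (n - i) * x i))"
    by (intro sum.cong refl sum_wrapping_arc_words) auto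
  finally show ?thesis .
qed

theorem theorem2p4:
  fixes n :: nat
  assumes "n \<ge> 2"
  shows "(\<Sum>\<pi>\<in>arc_permutations n. tt ^ inversions n \<pi> * (\<Prod>i\<in>descents n \<pi>. xx i)) =
    (\<Prod>i=1..n-1. 1 + tt ^ i * xx i) +
    (\<Sum>j=1..n-2. (tt ^ (j * (n - j)) * xx j + tt ^ (n - j - 1) * xx (j + 1)) *
       (\<Prod>i=1..j-1. 1 + tt ^ i * xx i) * (\<Prod>i=j+2..n-1. 1 + tt ^ (n - i) * xx i))"
proof -
  have "(\<Sum>\<pi>\<in>arc_permutations n. tt ^ inversions n \<pi> * (\<Prod>i\<in>descents n \<pi>. xx i)) =
      (\<Sum>\<pi>\<in>arc_permutations n. word_weight tt xx 1 (map \<pi> [1..<Suc n]))"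
    by (simp only: word_weight_permutation)
  also have "\<dots> = (\<Sum>xs\<in>arc_words n. word_weight tt xx 1 xs)"
    by (rule sum.reindex_bij_betw[OF bij_betw_arc_words])
  also have "\<dots> = (\<Prod>i=1..n-1. 1 + tt ^ i * xx i) +
    (\<Sum>j=1..n-2. (tt ^ (j * (n - j)) * xx j + tt ^ (n - j - 1) * xx (j + 1)) *
       (\<Prod>i=1..j-1. 1 + tt ^ i * xx i) * (\<Prod>i=j+2..n-1. 1 + tt ^ (n - i) * xx i))"
    by (rule sum_arc_words) (use assms in simp)
  finally show ?thesis .
qed

end
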